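(* Let $\mathbf{X}\in\mathbb{R}^{n\times p}$, $\mathbf{y}\in\mathbb{R}^n$, and let $S_{k-1}\subset\{1,\dots,p\}$ be a nonempty index set such that $\mathbf{X}_{S_{k-1}}$ has full column rank. Let $\mathbf{C}_{k-1}=(\mathbf{X}_{S_{k-1}}^T\mathbf{X}_{S_{k-1}})^{-1}$, and for $j\in S_{k-1}$, if $j$ is the $i$-th element of $S_{k-1}$, let $\mathbf{e}_j=(\delta_{1i},\delta_{2i},\dots,\delta_{|S_{k-1}|\,i})^T\in\mathbb{R}^{|S_{k-1}|}$ be the $i$-th standard basis vector. Then the problem $$\operatorname*{argmax}_{S}\ \mathbf{y}^T\mathbf{X}_S(\mathbf{X}_S^T\mathbf{X}_S)^{-1}\mathbf{X}_S^T\mathbf{y}\quad\text{subject to } S\subset S_{k-1},\ |S|=|S_{k-1}|-1$$ is equivalent, in the sense of identifying the same subset, to the problem $$\operatorname*{argmax}_{j\in S_{k-1}}\ \mathbf{y}^T\mathbf{X}_{S_{k-1}}(\mathbf{I}-\mathbf{e}_j\mathbf{e}_j^T)\left(\mathbf{C}_{k-1}-\frac{\mathbf{C}_{k-1}\mathbf{e}_j\mathbf{e}_j^T\mathbf{C}_{k-1}}{\mathbf{e}_j^T\mathbf{C}_{k-1}\mathbf{e}_j}\right)(\mathbf{I}-\mathbf{e}_j\mathbf{e}_j^T)\mathbf{X}_{S_{k-1}}^T\mathbf{y}.$$ That is, an index $j\in S_{k-1}$ solves the second problem if and only if $S=S_{k-1}\setminus\{j\}$ solves the first.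
   Context: For an index set $S\subset\{1,\dots,p\}$, $\mathbf{X}_S$ is the submatrix of $\mathbf{X}$ consisting of the columns with index in $S$ (in the fixed order of the elements of $S$). $\delta_{ab}$ is the Kronecker delta. If $S$ is empty, $\mathbf{X}_S(\mathbf{X}_S^T\mathbf{X}_S)^{-1}\mathbf{X}_S^T$ is the zero matrix. In the paper $S_{k-1}$ is the support of the current coefficient vector $\boldsymbol{\beta}^{k-1}$. *)

theory Defs
  imports
    "Jordan_Normal_Form.Gauss_Jordan_Elimination"
    "Jordan_Normal_Form.DL_Submatrix"
    "Jordan_Normal_Form.DL_Rank"
begin

text \<open>
  Columns are numbered from 0, as in the matrix library, so index sets are subsets of
  \<open>{..<p}\<close> rather than of \<open>{1,\<dots>,p}\<close>.
\<close>

definition col_submatrix :: "real mat \<Rightarrow> nat set \<Rightarrow> real mat" where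
  "col_submatrix X S = submatrix X UNIV S"

text \<open>
  The inverse Gram matrix of the columns in \<open>S\<close>; unspecified if the Gram matrix is singular.
\<close>
definition gram_inverse :: "real mat \<Rightarrow> nat set \<Rightarrow> real mat" where
  "gram_inverse X S = the (mat_inverse ((col_submatrix X S)\<^sup>T * col_submatrix X S))"

definition hat_matrix :: "real mat \<Rightarrow> nat set \<Rightarrow> real mat" where
  "hat_matrix X S = col_submatrix X S * gram_inverse X S * (col_submatrix X S)\<^sup>T"

text \<open>
  The formula for \<^const>\<open>hat_matrix\<close> needs no separate clause for the empty index set: the
  Gram matrix is then the invertible 0-by-0 matrix, and the product is the zero matrix.
\<close>
lemma hat_matrix_empty:
  assumes "X \<in> carrier_mat n p"
  shows "hat_matrix X {} = 0\<^sub>m n n"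
proof -
  let ?A = "col_submatrix X {}"
  have A: "?A \<in> carrier_mat n 0"
    using assms by (auto simp: col_submatrix_def dim_submatrix)
  then have G: "?A\<^sup>T * ?A \<in> carrier_mat 0 0" by auto
  then have "?A\<^sup>T * ?A = 1\<^sub>m 0" by (intro eq_matI) auto
  then have "?A\<^sup>T * ?A \<in> Units (ring_mat TYPE(real) 0 ())"
    by (auto simp: Units_def ring_mat_def)
  with mat_inverse(1)[OF G, where b = "()"] obtain B where B: "mat_inverse (?A\<^sup>T * ?A) = Some B"
    by (cases "mat_inverse (?A\<^sup>T * ?A)") auto
  then have "gram_inverse X {} \<in> carrier_mat 0 0"
    using mat_inverse(2)[OF G B] by (simp add: gram_inverse_def)
  with A show ?thesis
    unfolding hat_matrix_def by (intro eq_matI) (auto simp: scalar_prod_def)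
qed

text \<open>
  The standard basis vector of length \<open>card S\<close> attached to \<open>j \<in> S\<close>: its nonzero entry sits at
  the position of \<open>j\<close> in the increasing enumeration \<^term>\<open>pick S\<close> of \<open>S\<close>, which is also the
  order of the columns of \<^term>\<open>col_submatrix X S\<close>.
\<close>
definition basis_vec_at :: "nat set \<Rightarrow> nat \<Rightarrow> real vec" where
  "basis_vec_at S j = unit_vec (card S) (THE i. i < card S \<and> pick S i = j)"

lemma basis_vec_at_eq:
  assumes "finite S" and "j \<in> S"
  shows "basis_vec_at S j = unit_vec (card S) (card {a \<in> S. a < j})"
proof -
  have "card {a \<in> S. a < j} < card S"
    using assms by (intro psubset_card_mono) auto
  then have "(THE i. i < card S \<and> pick S i = j) = card {a \<in> S. a < j}"
    using pick_card_in_set[OF assms(2)] card_pick_le[of _ S] by (intro the_equality) auto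
  then show ?thesis by (simp add: basis_vec_at_def)
qed

definition outer_prod :: "real vec \<Rightarrow> real vec \<Rightarrow> real mat" where
  "outer_prod u v = mat (dim_vec u) (dim_vec v) (\<lambda>(i, j). u $ i * v $ j)"

definition subset_objective :: "real mat \<Rightarrow> real vec \<Rightarrow> nat set \<Rightarrow> real" where
  "subset_objective X y S = y \<bullet> (hat_matrix X S *\<^sub>v y)"

definition deletion_objective :: "real mat \<Rightarrow> real vec \<Rightarrow> nat set \<Rightarrow> nat \<Rightarrow> real" where
  "deletion_objective X y S j =
    (let A = col_submatrix X S;
         C = gram_inverse X S;
         e = basis_vec_at S j;
         E = outer_prod e e;
         I = 1\<^sub>m (card S)
     in y \<bullet> ((A * (I - E) * (C - (1 / (e \<bullet> (C *\<^sub>v e))) \<cdot>\<^sub>m (C * E * C)) * (I - E) * A\<^sup>T) *\<^sub>v y))"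

end

theory Submission
  imports Defs
begin

text \<open>
  The two problems agree because their objectives agree pointwise: the deletion objective of \<open>S\<close>
  at \<open>j\<close> is the subset objective of \<open>S - {j}\<close>, and the subsets of \<open>S\<close> with one element
  fewer are exactly the sets \<open>S - {j}\<close> with \<open>j \<in> S\<close>.

  For the pointwise identity, let \<open>A\<close> consist of the columns in \<open>S\<close>, let \<open>C\<close> be the inverse of
  \<open>G = A\<^sup>T * A\<close>, and let \<open>P\<close> be the identity matrix without its column at the position of \<open>j\<close>.
  Then \<open>A * P\<close> consists of the columns in \<open>S - {j}\<close>, its Gram matrix is \<open>P\<^sup>T * G * P\<close>, and
  \<open>P\<^sup>T * P = I\<close> while \<open>P * P\<^sup>T = I - E\<close> for \<open>E = e * e\<^sup>T\<close>. The correction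
  \<open>M = C - C * E * C / (e\<^sup>T * C * e)\<close> is chosen so that its row at the position of \<open>j\<close> vanishes,
  that is \<open>P * P\<^sup>T * M = M\<close>, and so that \<open>G * M = I - E * C / (e\<^sup>T * C * e)\<close>, whose second
  term is killed by \<open>P\<^sup>T\<close>. Hence
  \<open>(P\<^sup>T * G * P) * (P\<^sup>T * M * P) = P\<^sup>T * G * M * P = P\<^sup>T * P = I\<close>, so \<open>P\<^sup>T * M * P\<close>
  is the inverse Gram matrix for \<open>S - {j}\<close> (lemma \<open>compressed_inverse\<close>). The hat matrix of
  \<open>S - {j}\<close> is therefore \<open>A * (P * P\<^sup>T) * M * (P * P\<^sup>T) * A\<^sup>T\<close>, which is the matrix in the
  deletion objective.

  Full column rank makes \<open>G\<close> invertible. The divisor \<open>e\<^sup>T * C * e\<close> is then nonzero: it is the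
  squared norm of \<open>A * C * e\<close>, a vector that \<open>A\<^sup>T\<close> maps to \<open>e\<close>.
\<close>

section \<open>Inverses of Gram matrices\<close>

text \<open>
  Over a field a right inverse of a square matrix is two-sided, hence unique, so exhibiting one
  determines what \<^const>\<open>mat_inverse\<close> returns.
\<close>
lemma mat_inverse_eq_Some:
  fixes G H :: "'a :: field mat"
  assumes G: "G \<in> carrier_mat k k" and H: "H \<in> carrier_mat k k" and GH: "G * H = 1\<^sub>m k"
  shows "mat_inverse G = Some H"
proof -
  have HG: "H * G = 1\<^sub>m k" using mat_mult_left_right_inverse[OF G H GH] .
  have "G \<in> Units (ring_mat TYPE('a) k ())"
    using G H GH HG by (auto simp: Units_def ring_mat_def)
  then obtain B where B: "mat_inverse G = Some B"
    using mat_inverse(1)[OF G, where b = "()"] by (cases "mat_inverse G") auto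
  then have BG: "B * G = 1\<^sub>m k" and Bc: "B \<in> carrier_mat k k"
    using mat_inverse(2)[OF G] by auto
  have "B = B * (G * H)" using Bc GH by simp
  also have "\<dots> = (B * G) * H" using Bc G H by simp
  also have "\<dots> = H" using BG H by simp
  finally show ?thesis using B by simp
qed

text \<open>
  The quadratic form of a Gram matrix at \<open>v\<close> is the squared norm of \<open>A *\<^sub>v v\<close>. Vanishing of the
  form is a weaker hypothesis than \<open>(A\<^sup>T * A) *\<^sub>v v = 0\<close>; the weaker one is what the
  nonvanishing of the divisor \<open>e\<^sup>T * C * e\<close> needs.
\<close>
lemma gram_kernel:
  fixes A :: "real mat"
  assumes A: "A \<in> carrier_mat n k" and v: "v \<in> carrier_vec k"
    and zero: "v \<bullet> ((A\<^sup>T * A) *\<^sub>v v) = 0"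
  shows "A *\<^sub>v v = 0\<^sub>v n"
proof -
  have Av: "A *\<^sub>v v \<in> carrier_vec n" using A v by simp
  have "(A *\<^sub>v v) \<bullet> (A *\<^sub>v v) = v \<bullet> (A\<^sup>T *\<^sub>v (A *\<^sub>v v))"
    using transpose_vec_mult_scalar[of "A\<^sup>T" k n "A *\<^sub>v v" v] A v Av by simp
  also have "A\<^sup>T *\<^sub>v (A *\<^sub>v v) = (A\<^sup>T * A) *\<^sub>v v"
    using A v assoc_mult_mat_vec[of "A\<^sup>T" k n A k v] by simp
  also note zero
  finally have "(A *\<^sub>v v) \<bullet> (A *\<^sub>v v) = 0" .
  \<comment> \<open>Definiteness is available for the conjugated square, which is the plain one over the reals.\<close>
  moreover have "conjugate (A *\<^sub>v v) = A *\<^sub>v v" by (intro eq_vecI) auto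
  ultimately show ?thesis using conjugate_square_eq_0_vec[OF Av] by simp
qed

lemma full_column_rank_kernel:
  fixes A :: "real mat"
  assumes A: "A \<in> carrier_mat n k" and rk: "vec_space.rank n A = k"
    and v: "v \<in> carrier_vec k" and Av: "A *\<^sub>v v = 0\<^sub>v n"
  shows "v = 0\<^sub>v k"
proof -
  interpret vec_space "TYPE(real)" n .
  \<comment> \<open>A repeated column would leave fewer than \<open>k\<close> candidates for an independent set.\<close>
  obtain U where U: "maximal U (\<lambda>T. T \<subseteq> set (cols A) \<and> lin_indpt T)"
    using maximal_exists_superset[of "set (cols A)" "\<lambda>T. T \<subseteq> set (cols A) \<and> lin_indpt T" "{}"]
    by (auto simp: finite_lin_indpt2)
  then have "U \<subseteq> set (cols A)" by (simp add: maximal_def)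
  then have "k \<le> card (set (cols A))"
    using rank_card_indpt[OF A U] rk card_mono[of "set (cols A)" U] by simp
  then have d: "distinct (cols A)"
    using A card_length[of "cols A"] by (intro card_distinct) auto
  show ?thesis
    using lin_depI[OF A v _ Av d] full_rank_lin_indpt[OF A rk d] by auto
qed

lemma full_column_rank_gram_inverse:
  fixes A :: "real mat"
  assumes A: "A \<in> carrier_mat n k" and rk: "vec_space.rank n A = k"
  obtains C where "mat_inverse (A\<^sup>T * A) = Some C" "C \<in> carrier_mat k k" "A\<^sup>T * A * C = 1\<^sub>m k"
proof -
  let ?G = "A\<^sup>T * A"
  have G: "?G \<in> carrier_mat k k" using A by simp
  have "det ?G \<noteq> 0"
  proof
    assume "det ?G = 0"
    then obtain v where v: "v \<in> carrier_vec k" "v \<noteq> 0\<^sub>v k" "?G *\<^sub>v v = 0\<^sub>v k"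
      using det_0_iff_vec_prod_zero_field[OF G] by auto
    have "A *\<^sub>v v = 0\<^sub>v n" using gram_kernel[OF A v(1)] v by simp
    then show False using full_column_rank_kernel[OF A rk v(1)] v(2) by simp
  qed
  then obtain C where "C \<in> carrier_mat k k" "?G * C = 1\<^sub>m k"
    using det_non_zero_imp_unit[OF G, where b = "()"] by (auto simp: Units_def ring_mat_def)
  then show thesis using that mat_inverse_eq_Some[OF G] by blast
qed

text \<open>
  Write \<open>w = C *\<^sub>v e\<close>, so that \<open>(A\<^sup>T * A) *\<^sub>v w = e\<close>. Then \<open>e \<bullet> w\<close> is the quadratic form of
  the Gram matrix at \<open>w\<close>; if it were zero, \<open>A *\<^sub>v w\<close> and hence \<open>e\<close> would vanish.
\<close>
lemma gram_inverse_quadratic_form_nonzero: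
  fixes A :: "real mat"
  assumes A: "A \<in> carrier_mat n k" and C: "C \<in> carrier_mat k k"
    and GC: "A\<^sup>T * A * C = 1\<^sub>m k" and e: "e \<in> carrier_vec k" "e \<noteq> 0\<^sub>v k"
  shows "e \<bullet> (C *\<^sub>v e) \<noteq> 0"
proof
  assume zero: "e \<bullet> (C *\<^sub>v e) = 0"
  have Ce: "C *\<^sub>v e \<in> carrier_vec k" using C e by simp
  have Ge: "(A\<^sup>T * A) *\<^sub>v (C *\<^sub>v e) = e"
    using assoc_mult_mat_vec[of "A\<^sup>T * A" k k C k e] A C e GC by simp
  have "A *\<^sub>v (C *\<^sub>v e) = 0\<^sub>v n"
    using gram_kernel[OF A Ce] zero comm_scalar_prod[OF e(1) Ce] Ge by simp
  then have "A\<^sup>T *\<^sub>v (A *\<^sub>v (C *\<^sub>v e)) = 0\<^sub>v k" using A by (intro eq_vecI) auto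
  then show False using Ge e assoc_mult_mat_vec[of "A\<^sup>T" k n A k "C *\<^sub>v e"] A Ce by simp
qed

section \<open>Inverting a principal submatrix\<close>

text \<open>
  Associativity with side conditions in which every variable is fixed by the products themselves;
  as a rewrite rule it normalises long products without any dimension having to be guessed.
\<close>
lemma mult_mat_assoc_dims:
  fixes A B C :: "'a :: semiring_0 mat"
  assumes "dim_col A = dim_row B" and "dim_col B = dim_row C"
  shows "A * B * C = A * (B * C)"
proof -
  have "A \<in> carrier_mat (dim_row A) (dim_col A)" by (rule carrier_matI[OF refl refl])
  moreover have "B \<in> carrier_mat (dim_col A) (dim_col B)"
    by (rule carrier_matI[OF assms(1)[symmetric] refl])
  moreover have "C \<in> carrier_mat (dim_col B) (dim_col C)"
    by (rule carrier_matI[OF assms(2)[symmetric] refl])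
  ultimately show ?thesis by (rule assoc_mult_mat)
qed

lemma mult_outer_prod:
  assumes "N \<in> carrier_mat m k" and "u \<in> carrier_vec k"
  shows "N * outer_prod u v = outer_prod (N *\<^sub>v u) v"
  using assms
  by (intro eq_matI) (auto simp: outer_prod_def scalar_prod_def sum_distrib_right mult.assoc)

lemma outer_prod_mult_outer_prod:
  assumes "v \<in> carrier_vec k" and "w \<in> carrier_vec k"
  shows "outer_prod u v * outer_prod w z = (v \<bullet> w) \<cdot>\<^sub>m outer_prod u z"
  using assms
  by (intro eq_matI)
    (auto simp: outer_prod_def scalar_prod_def sum_distrib_left mult_ac)

lemma outer_prod_sandwich:
  assumes C: "C \<in> carrier_mat k k" and e: "e \<in> carrier_vec k"
  shows "outer_prod e e * C * outer_prod e e = (e \<bullet> (C *\<^sub>v e)) \<cdot>\<^sub>m outer_prod e e"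
proof -
  have E: "outer_prod e e \<in> carrier_mat k k" using e by (auto simp: outer_prod_def)
  have "outer_prod e e * C * outer_prod e e = outer_prod e e * (C * outer_prod e e)"
    using E C by simp
  also have "\<dots> = (e \<bullet> (C *\<^sub>v e)) \<cdot>\<^sub>m outer_prod e e"
    using C e by (simp add: mult_outer_prod outer_prod_mult_outer_prod[of _ k])
  finally show ?thesis .
qed

text \<open>
  The columns of \<open>P\<close> are an orthonormal basis of the range of the projection \<open>1 - E\<close>, and the
  inverse of the compression of \<open>G\<close> to that range is the compression of the corrected inverse
  \<open>M\<close>. The identity \<open>E * C * E = c \<cdot>\<^sub>m E\<close>, which expresses that \<open>E\<close> has rank one, gives
  \<open>E * M = 0\<close>, so \<open>M\<close> already maps into the range, and \<open>P\<^sup>T * E = 0\<close> removes the error term of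
  \<open>G * M\<close>.
\<close>
lemma compressed_inverse:
  fixes G C E P :: "real mat"
  assumes G: "G \<in> carrier_mat k k" and C: "C \<in> carrier_mat k k" and E: "E \<in> carrier_mat k k"
    and P: "P \<in> carrier_mat k m"
    and GC: "G * C = 1\<^sub>m k" and PP: "P\<^sup>T * P = 1\<^sub>m m" and PPt: "P * P\<^sup>T = 1\<^sub>m k - E"
    and ECE: "E * C * E = c \<cdot>\<^sub>m E" and c: "c \<noteq> 0"
  defines "M \<equiv> C - (1 / c) \<cdot>\<^sub>m (C * E * C)"
  shows "(P\<^sup>T * G * P) * (P\<^sup>T * M * P) = 1\<^sub>m m"
proof -
  have M: "M \<in> carrier_mat k k" using C E by (simp add: M_def minus_carrier_mat)
  note [simp] = carrier_matD[OF G] carrier_matD[OF C] carrier_matD[OF E] carrier_matD[OF M]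
    carrier_matD[OF P]
  have "E * (C * E * C) = c \<cdot>\<^sub>m (E * C)"
  proof -
    have "E * (C * E * C) = (E * C * E) * C" by (simp add: mult_mat_assoc_dims)
    also have "\<dots> = c \<cdot>\<^sub>m (E * C)" unfolding ECE by (rule mult_smult_assoc_mat[OF E C])
    finally show ?thesis .
  qed
  moreover have "E * M = E * C - (1 / c) \<cdot>\<^sub>m (E * (C * E * C))"
    unfolding M_def using C E
    by (simp add: mult_minus_distrib_mat[of _ k k _ k] mult_smult_distrib[of _ k k _ k])
  ultimately have EM: "E * M = 0\<^sub>m k k" using C E c by (intro eq_matI) auto
  have "P * P\<^sup>T * M = M - E * M"
    unfolding PPt using E M by (simp add: minus_mult_distrib_mat[of _ k k _ _ k])
  then have PPM: "P * P\<^sup>T * M = M" unfolding EM using M by (intro eq_matI) auto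
  have "G * M = G * C - (1 / c) \<cdot>\<^sub>m (G * (C * E * C))"
    unfolding M_def using G C E
    by (simp add: mult_minus_distrib_mat[of _ k k _ k] mult_smult_distrib[of _ k k _ k])
  moreover have "G * (C * E * C) = E * C"
  proof -
    have "G * (C * E * C) = (G * C) * (E * C)" by (simp add: mult_mat_assoc_dims)
    then show ?thesis using GC C E by simp
  qed
  ultimately have GM: "G * M = 1\<^sub>m k - (1 / c) \<cdot>\<^sub>m (E * C)" using GC by simp
  have "P\<^sup>T * (1\<^sub>m k - P * P\<^sup>T) = P\<^sup>T - P\<^sup>T * P * P\<^sup>T"
    using P by (simp add: mult_minus_distrib_mat[of _ m k _ k])
  also have "\<dots> = 0\<^sub>m m k" using P by (simp add: PP)
  also have "1\<^sub>m k - P * P\<^sup>T = E" unfolding PPt using E by (intro eq_matI) auto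
  finally have PtE: "P\<^sup>T * E = 0\<^sub>m m k" .
  have "P\<^sup>T * (G * M) = P\<^sup>T - (1 / c) \<cdot>\<^sub>m (P\<^sup>T * E * C)"
    unfolding GM using P E C
    by (simp add: mult_minus_distrib_mat[of _ m k _ k] mult_smult_distrib[of _ m k _ k])
  also have "\<dots> = P\<^sup>T" unfolding PtE using P C by (intro eq_matI) auto
  finally have PGM: "P\<^sup>T * (G * M) = P\<^sup>T" .
  have "(P\<^sup>T * G * P) * (P\<^sup>T * M * P) = P\<^sup>T * (G * (P * P\<^sup>T * M)) * P"
    by (simp add: mult_mat_assoc_dims)
  also have "\<dots> = P\<^sup>T * (G * M) * P" unfolding PPM ..
  finally show ?thesis unfolding PGM PP .
qed

section \<open>Selecting columns by a matrix product\<close>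

lemma col_submatrix_carrier:
  assumes "X \<in> carrier_mat n p" and "S \<subseteq> {..<p}"
  shows "col_submatrix X S \<in> carrier_mat n (card S)"
proof -
  have "{j. j < p \<and> j \<in> S} = S" using assms by auto
  then show ?thesis using assms by (auto simp: col_submatrix_def dim_submatrix)
qed

lemma col_submatrix_index:
  assumes "X \<in> carrier_mat n p" and "S \<subseteq> {..<p}" and "i < n" and "a < card S"
  shows "col_submatrix X S $$ (i, a) = X $$ (i, pick S a)"
proof -
  have "{j. j < p \<and> j \<in> S} = S" using assms by auto
  then show ?thesis using assms by (simp add: col_submatrix_def submatrix_index pick_UNIV)
qed

text \<open>The position of an element is recovered as the number of smaller elements.\<close>
lemma pick_eq_iff:
  assumes "a < card S" and "b < card S"
  shows "pick S a = pick S b \<longleftrightarrow> a = b"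
proof
  assume "pick S a = pick S b"
  then have "card {x \<in> S. x < pick S a} = card {x \<in> S. x < pick S b}" by (simp only:)
  then show "a = b" by (simp only: card_pick_le[OF assms(1)] card_pick_le[OF assms(2)])
qed (simp only:)

lemma bij_betw_pick:
  assumes "finite S"
  shows "bij_betw (pick S) {..<card S} S"
proof -
  have inj: "inj_on (pick S) {..<card S}"
    by (auto intro!: inj_onI simp: pick_eq_iff)
  moreover have "pick S ` {..<card S} \<subseteq> S" by (auto intro: pick_in_set_le)
  ultimately show ?thesis
    using assms card_subset_eq[of S "pick S ` {..<card S}"]
    by (simp add: bij_betw_def card_image)
qed

text \<open>
  For \<open>T \<subseteq> S\<close> this is the matrix, in the coordinates given by the increasing enumerations, of
  extending a vector indexed by \<open>T\<close> to one indexed by \<open>S\<close> by zeros.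
\<close>
definition inclusion_mat :: "nat set \<Rightarrow> nat set \<Rightarrow> real mat" where
  "inclusion_mat S T =
    mat (card S) (card T) (\<lambda>(a, b). if pick S a = pick T b then 1 else 0)"

lemma inclusion_mat_carrier [simp]: "inclusion_mat S T \<in> carrier_mat (card S) (card T)"
  by (simp add: inclusion_mat_def)

text \<open>
  Entries of products of column submatrices and inclusion matrices are sums over positions; this
  turns them into sums over the column indices themselves, where Kronecker deltas collapse.
\<close>
lemma sum_pick:
  assumes "finite S"
  shows "(\<Sum>a = 0..<card S. f (pick S a)) = sum f S"
  using sum.reindex_bij_betw[OF bij_betw_pick[OF assms], of f] by (simp only: atLeast0LessThan)

lemma col_submatrix_subset:
  assumes X: "X \<in> carrier_mat n p" and S: "S \<subseteq> {..<p}" and T: "T \<subseteq> S"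
  shows "col_submatrix X T = col_submatrix X S * inclusion_mat S T"
proof (rule eq_matI, goal_cases)
  case (1 i b)
  have fin: "finite S" using finite_subset[OF S] by simp
  have A: "col_submatrix X S \<in> carrier_mat n (card S)" using col_submatrix_carrier X S by blast
  have i: "i < n" and b: "b < card T" using 1 A by (auto simp: inclusion_mat_def)
  have bS: "pick T b \<in> S" using pick_in_set_le[OF b] T by blast
  have "(col_submatrix X S * inclusion_mat S T) $$ (i, b)
      = (\<Sum>a = 0..<card S. X $$ (i, pick S a) * (if pick S a = pick T b then 1 else 0))"
    using A i b X S by (simp add: scalar_prod_def inclusion_mat_def col_submatrix_index)
  also have "\<dots> = (\<Sum>s\<in>S. X $$ (i, s) * (if s = pick T b then 1 else 0))"
    by (rule sum_pick[OF fin])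
  also have "\<dots> = X $$ (i, pick T b)" using fin bS by (simp add: if_distrib cong: if_cong)
  finally show ?case using X S T i b by (simp add: col_submatrix_index)
next
  have "T \<subseteq> {..<p}" using S T by blast
  note carrier_matD[OF col_submatrix_carrier[OF X S], simp]
    carrier_matD[OF col_submatrix_carrier[OF X this], simp]
  case 2 show ?case by simp
  case 3 show ?case by (simp add: inclusion_mat_def)
qed

lemma inclusion_mat_orthonormal:
  assumes "finite S" and "T \<subseteq> S"
  shows "(inclusion_mat S T)\<^sup>T * inclusion_mat S T = 1\<^sub>m (card T)"
proof (rule eq_matI, goal_cases)
  case (1 a b)
  then have a: "a < card T" and b: "b < card T" by auto
  have aS: "pick T a \<in> S" using pick_in_set_le[OF a] assms by blast
  have "((inclusion_mat S T)\<^sup>T * inclusion_mat S T) $$ (a, b)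
      = (\<Sum>i = 0..<card S. (if pick S i = pick T a then 1 else 0)
           * (if pick S i = pick T b then 1 else 0))"
    using a b by (simp add: scalar_prod_def inclusion_mat_def)
  also have "\<dots> = (\<Sum>s\<in>S. (if s = pick T a then 1 else 0) * (if s = pick T b then 1 else 0))"
    by (rule sum_pick[OF assms(1)])
  also have "\<dots> = (\<Sum>s\<in>S. if s = pick T a then (if pick T a = pick T b then 1 else 0) else 0)"
    by (intro sum.cong) auto
  also have "\<dots> = (if pick T a = pick T b then 1 else 0)" using assms(1) aS by simp
  finally show ?case using a b by (simp add: pick_eq_iff)
next
  case 2 show ?case by (simp add: inclusion_mat_def)
  case 3 show ?case by (simp add: inclusion_mat_def)
qed

text \<open>
  Restricting a vector from \<open>S\<close> to \<open>S - {j}\<close> and extending it by zero again clears its entry at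
  the position of \<open>j\<close>; this is where the factors \<open>I - e * e\<^sup>T\<close> of the deletion objective come
  from.
\<close>
lemma inclusion_mat_projection:
  assumes "finite S" and j: "j \<in> S"
  shows "inclusion_mat S (S - {j}) * (inclusion_mat S (S - {j}))\<^sup>T
    = 1\<^sub>m (card S) - outer_prod (basis_vec_at S j) (basis_vec_at S j)"
proof (rule eq_matI, goal_cases)
  let ?T = "S - {j}" and ?i = "card {a \<in> S. a < j}"
  have e: "basis_vec_at S j = unit_vec (card S) ?i" using basis_vec_at_eq assms by blast
  case (1 a b)
  then have a: "a < card S" and b: "b < card S" by (auto simp: e outer_prod_def)
  have fin: "finite ?T" using assms by simp
  have pj: "pick S c = j \<longleftrightarrow> c = ?i" if "c < card S" for c
    using card_pick_le[OF that] pick_card_in_set[OF j] by auto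
  have "(inclusion_mat S ?T * (inclusion_mat S ?T)\<^sup>T) $$ (a, b)
      = (\<Sum>i = 0..<card ?T. (if pick S a = pick ?T i then 1 else 0)
           * (if pick S b = pick ?T i then 1 else 0))"
    using a b by (simp add: scalar_prod_def inclusion_mat_def)
  also have "\<dots> = (\<Sum>s\<in>?T. (if pick S a = s then 1 else 0) * (if pick S b = s then 1 else 0))"
    by (rule sum_pick[OF fin])
  also have "\<dots> = (\<Sum>s\<in>?T. if s = pick S a then (if a = b then 1 else 0) else 0)"
    using pick_eq_iff[OF a b] by (intro sum.cong) auto
  also have "\<dots> = (if a = b \<and> pick S a \<noteq> j then 1 else 0)"
    using fin pick_in_set_le[OF a] by simp
  finally show ?case using a b pj[OF a] by (auto simp: e outer_prod_def unit_vec_def)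
next
  case 2 show ?case by (simp add: inclusion_mat_def outer_prod_def basis_vec_at_def)
  case 3 show ?case by (simp add: inclusion_mat_def outer_prod_def basis_vec_at_def)
qed

section \<open>Comparing the two objectives\<close>

lemma deletion_objective_eq_subset_objective:
  assumes X: "X \<in> carrier_mat n p" and S: "S \<subseteq> {..<p}"
    and rk: "vec_space.rank n (col_submatrix X S) = card S" and j: "j \<in> S"
  shows "deletion_objective X y S j = subset_objective X y (S - {j})"
proof -
  let ?k = "card S" and ?m = "card (S - {j})"
  let ?A = "col_submatrix X S" and ?P = "inclusion_mat S (S - {j})"
  let ?e = "basis_vec_at S j"
  let ?E = "outer_prod ?e ?e" and ?C = "gram_inverse X S"
  let ?c = "?e \<bullet> (?C *\<^sub>v ?e)"
  let ?M = "?C - (1 / ?c) \<cdot>\<^sub>m (?C * ?E * ?C)"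
  let ?D = "1\<^sub>m ?k - ?E"
  have fin: "finite S" using finite_subset[OF S] by simp
  have A: "?A \<in> carrier_mat n ?k" using col_submatrix_carrier X S by blast
  have P: "?P \<in> carrier_mat ?k ?m" by simp
  obtain C' where C': "mat_inverse (?A\<^sup>T * ?A) = Some C'" "C' \<in> carrier_mat ?k ?k"
    "?A\<^sup>T * ?A * C' = 1\<^sub>m ?k"
    using full_column_rank_gram_inverse[OF A rk] by blast
  then have "?C = C'" by (simp add: gram_inverse_def)
  then have C: "?C \<in> carrier_mat ?k ?k" and GC: "?A\<^sup>T * ?A * ?C = 1\<^sub>m ?k" using C' by auto
  have ei: "?e = unit_vec ?k (card {a \<in> S. a < j})" using basis_vec_at_eq[OF fin j] .
  have "card {a \<in> S. a < j} < ?k" using fin j by (intro psubset_card_mono) auto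
  then have e: "?e \<in> carrier_vec ?k" "?e \<noteq> 0\<^sub>v ?k" by (auto simp: ei)
  have E: "?E \<in> carrier_mat ?k ?k" using e by (auto simp: outer_prod_def)
  have M: "?M \<in> carrier_mat ?k ?k" using C E by (simp add: minus_carrier_mat)
  have c: "?c \<noteq> 0" by (rule gram_inverse_quadratic_form_nonzero[OF A C GC e])
  note [simp] = carrier_matD[OF A] carrier_matD[OF C] carrier_matD[OF E] carrier_matD[OF P]
  have PPt: "?P * ?P\<^sup>T = ?D" by (rule inclusion_mat_projection[OF fin j])
  have AT: "col_submatrix X (S - {j}) = ?A * ?P" by (rule col_submatrix_subset[OF X S]) auto
  have G: "?A\<^sup>T * ?A \<in> carrier_mat ?k ?k" using A by simp
  have gram: "(?A * ?P)\<^sup>T * (?A * ?P) = ?P\<^sup>T * (?A\<^sup>T * ?A) * ?P"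
    by (simp add: transpose_mult[OF A P] mult_mat_assoc_dims)
  have "(?P\<^sup>T * (?A\<^sup>T * ?A) * ?P) * (?P\<^sup>T * ?M * ?P) = 1\<^sub>m ?m"
    using compressed_inverse[OF G C E P GC inclusion_mat_orthonormal[OF fin] PPt
      outer_prod_sandwich[OF C e(1)] c] by blast
  moreover have "?P\<^sup>T * (?A\<^sup>T * ?A) * ?P \<in> carrier_mat ?m ?m" using P G by auto
  moreover have "?P\<^sup>T * ?M * ?P \<in> carrier_mat ?m ?m" using P M by auto
  ultimately have "mat_inverse (?P\<^sup>T * (?A\<^sup>T * ?A) * ?P) = Some (?P\<^sup>T * ?M * ?P)"
    by (intro mat_inverse_eq_Some)
  then have inv: "gram_inverse X (S - {j}) = ?P\<^sup>T * ?M * ?P"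
    by (simp add: gram_inverse_def AT gram)
  have "hat_matrix X (S - {j}) = ?A * ?P * (?P\<^sup>T * ?M * ?P) * (?P\<^sup>T * ?A\<^sup>T)"
    by (simp add: hat_matrix_def AT inv transpose_mult[OF A P])
  \<comment> \<open>Regrouping alone brings out the two projections \<open>?P * ?P\<^sup>T\<close>.\<close>
  also have "\<dots> = ?A * (?P * ?P\<^sup>T) * ?M * (?P * ?P\<^sup>T) * ?A\<^sup>T"
    by (simp add: mult_mat_assoc_dims minus_carrier_mat)
  finally have "hat_matrix X (S - {j}) = ?A * ?D * ?M * ?D * ?A\<^sup>T" unfolding PPt .
  then show ?thesis
    by (simp add: deletion_objective_def subset_objective_def Let_def)
qed

lemma subset_card_minus_one_iff:
  assumes "finite S" and "S \<noteq> {}"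
  shows "T \<subseteq> S \<and> card T = card S - 1 \<longleftrightarrow> (\<exists>i\<in>S. T = S - {i})"
proof
  assume T: "T \<subseteq> S \<and> card T = card S - 1"
  have "card (S - T) = 1"
    using T assms card_Diff_subset[of T S] card_gt_0_iff[of S] finite_subset[of T S] by auto
  then obtain i where "S - T = {i}" by (auto simp: card_1_singleton_iff)
  then show "\<exists>i\<in>S. T = S - {i}" using T by auto
next
  assume "\<exists>i\<in>S. T = S - {i}"
  then show "T \<subseteq> S \<and> card T = card S - 1" using assms(1) by auto
qed

theorem theorem3p11:
  fixes X :: "real mat" and y :: "real vec" and n p j :: nat and S\<^sub>0 :: "nat set"
  assumes "X \<in> carrier_mat n p"
    and "y \<in> carrier_vec n"
    and "S\<^sub>0 \<subseteq> {..<p}"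
    and "S\<^sub>0 \<noteq> {}"
    and "vec_space.rank n (col_submatrix X S\<^sub>0) = card S\<^sub>0"
    and "j \<in> S\<^sub>0"
  shows "is_arg_max (deletion_objective X y S\<^sub>0) (\<lambda>i. i \<in> S\<^sub>0) j \<longleftrightarrow>
    is_arg_max (subset_objective X y) (\<lambda>S. S \<subseteq> S\<^sub>0 \<and> card S = card S\<^sub>0 - 1) (S\<^sub>0 - {j})"
proof -
  have fin: "finite S\<^sub>0" using finite_subset[OF assms(3)] by simp
  have "deletion_objective X y S\<^sub>0 i = subset_objective X y (S\<^sub>0 - {i})" if "i \<in> S\<^sub>0" for i
    using deletion_objective_eq_subset_objective[OF assms(1,3,5) that] .
  then show ?thesis
    unfolding is_arg_max_def subset_card_minus_one_iff[OF fin assms(4)] using assms(6) by auto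
qed

end
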